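(* If $\Gamma$ is a disconnected Coxeter graph, then the Coxeter group $W_\Gamma$ does not have Property (NL).
   Context: A Coxeter graph is a finite graph $\Gamma$ with vertices $s_1,\dots,s_n$ ($n\ge 1$) in which two distinct vertices $s_i,s_j$ may be joined by at most one edge (no loops), labelled by an integer $m_{ij}=m_{ji}\ge 2$. The associated Coxeter group $W_\Gamma$ has the presentation with generators $s_1,\dots,s_n$ and relations $s_i^2=1$ for all $i$, and $(s_is_j)^{m_{ij}}=1$ whenever $s_i$ and $s_j$ are joined by an edge labelled $m_{ij}$. (A missing edge means no relation between the two generators.) A geodesic metric space $X$ is hyperbolic if there is $\delta\ge 0$ such that for all $x,y,z\in X$ and all geodesics $[x,y],[y,z],[x,z]$, the side $[x,z]$ is contained in the $\delta$-neighborhood of $[x,y]\cup[y,z]$. For an isometric action of a group $G$ on a (nonempty) hyperbolic space $X$, an element $g\in G$ is loxodromic if the map $\mathbb{Z}\to X$, $n\mapsto g^n x_0$, is a quasi-isometric embedding for some (equivalently, every) $x_0\in X$. Here a map $q:Y\to X$ of metric spaces is a quasi-isometric embedding if there is $C\ge 1$ with $\frac1C d_Y(a,b)-C\le d_X(q(a),q(b))\le C d_Y(a,b)+C$ for all $a,b\in Y$. A group $G$ has Property (NL) if for every isometric action of $G$ on every hyperbolic space, no element of $G$ is loxodromic. *)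

theory Defs
  imports
    "HOL-Algebra.Group_Action"
    "HOL-Analysis.Abstract_Metric_Spaces"
    "Graph_Theory.Digraph_Component"
begin

section \<open>Groups given by generators and relators\<close>

text \<open>
  A letter is a pair \<open>(s, b)\<close>: the generator \<open>s\<close> if \<open>b\<close> is true, and its formal inverse otherwise.
  A relator \<open>r\<close> stands for the relation \<open>r = 1\<close>.
\<close>

type_synonym 'a word = "('a \<times> bool) list"

abbreviation words :: "'a set \<Rightarrow> 'a word set" where
  "words S \<equiv> lists (S \<times> UNIV)"

inductive pres_eq :: "'a set \<Rightarrow> 'a word set \<Rightarrow> 'a word \<Rightarrow> 'a word \<Rightarrow> bool" for S R where
  refl: "w \<in> words S \<Longrightarrow> pres_eq S R w w"
| sym: "pres_eq S R u v \<Longrightarrow> pres_eq S R v u"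
| trans: "pres_eq S R u v \<Longrightarrow> pres_eq S R v w \<Longrightarrow> pres_eq S R u w"
| cancel: "u \<in> words S \<Longrightarrow> v \<in> words S \<Longrightarrow> s \<in> S \<Longrightarrow>
    pres_eq S R (u @ [(s, b), (s, \<not> b)] @ v) (u @ v)"
| relator: "u \<in> words S \<Longrightarrow> v \<in> words S \<Longrightarrow> r \<in> R \<Longrightarrow> r \<in> words S \<Longrightarrow>
    pres_eq S R (u @ r @ v) (u @ v)"

definition pres_rel :: "'a set \<Rightarrow> 'a word set \<Rightarrow> 'a word rel" where
  "pres_rel S R = {(u, v). pres_eq S R u v}"

definition presented_group :: "'a set \<Rightarrow> 'a word set \<Rightarrow> 'a word set monoid" where
  "presented_group S R =
    \<lparr>carrier = words S // pres_rel S R,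
     monoid.mult = (\<lambda>A B. \<Union>a\<in>A. \<Union>b\<in>B. pres_rel S R `` {a @ b}),
     one = pres_rel S R `` {[]}\<rparr>"

lemma pres_eq_words: "pres_eq S R u v \<Longrightarrow> u \<in> words S \<and> v \<in> words S"
  by (induction rule: pres_eq.induct) auto

lemma pres_eq_append_left: "pres_eq S R u v \<Longrightarrow> w \<in> words S \<Longrightarrow> pres_eq S R (w @ u) (w @ v)"
proof (induction rule: pres_eq.induct)
  case (cancel u v s b)
  then show ?case
    using pres_eq.cancel[of "w @ u" S v s R b] by auto
next
  case (relator u v r)
  then show ?case
    using pres_eq.relator[of "w @ u" S v r R] by auto
next
  case (refl v)
  then show ?case by (intro pres_eq.refl) simp
next
  case (sym u v)
  then show ?case by (metis pres_eq.sym)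
next
  case (trans u v x)
  then show ?case by (metis pres_eq.trans)
qed

lemma pres_eq_append_right: "pres_eq S R u v \<Longrightarrow> w \<in> words S \<Longrightarrow> pres_eq S R (u @ w) (v @ w)"
proof (induction rule: pres_eq.induct)
  case (cancel u v s b)
  then show ?case
    using pres_eq.cancel[of u S "v @ w" s R b] by auto
next
  case (relator u v r)
  then show ?case
    using pres_eq.relator[of u S "v @ w" r R] by auto
next
  case (refl v)
  then show ?case by (intro pres_eq.refl) simp
next
  case (sym u v)
  then show ?case by (metis pres_eq.sym)
next
  case (trans u v x)
  then show ?case by (metis pres_eq.trans)
qed

lemma pres_eq_append:
  "pres_eq S R u u' \<Longrightarrow> pres_eq S R v v' \<Longrightarrow> pres_eq S R (u @ v) (u' @ v')"
  by (meson pres_eq.trans pres_eq_append_left pres_eq_append_right pres_eq_words)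

lemma equiv_pres_rel: "equiv (words S) (pres_rel S R)"
proof (rule equivI)
  show "pres_rel S R \<subseteq> words S \<times> words S"
    unfolding pres_rel_def using pres_eq_words by blast
  show "refl_on (words S) (pres_rel S R)"
    by (rule refl_onI) (simp add: pres_rel_def pres_eq.refl del: in_lists_conv_set)
  show "sym (pres_rel S R)"
    by (rule symI) (simp add: pres_rel_def pres_eq.sym)
  show "trans (pres_rel S R)"
    by (rule transI) (simp add: pres_rel_def, rule pres_eq.trans)
qed

lemma presented_group_mult:
  assumes "a \<in> words S" "b \<in> words S"
  shows "(pres_rel S R `` {a}) \<otimes>\<^bsub>presented_group S R\<^esub> (pres_rel S R `` {b}) = pres_rel S R `` {a @ b}"
proof -
  have "congruent2 (pres_rel S R) (pres_rel S R) (\<lambda>x y. pres_rel S R `` {x @ y})"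
    by (intro congruent2I' equiv_class_eq[OF equiv_pres_rel])
      (auto simp: pres_rel_def intro: pres_eq_append)
  then show ?thesis
    unfolding presented_group_def
    using UN_equiv_class2[OF equiv_pres_rel equiv_pres_rel _ assms] by simp
qed

definition inverse_word :: "'a word \<Rightarrow> 'a word" where
  "inverse_word w = rev (map (\<lambda>(s, b). (s, \<not> b)) w)"

lemma inverse_word_words: "w \<in> words S \<Longrightarrow> inverse_word w \<in> words S"
  by (auto simp: inverse_word_def)

lemma pres_eq_inverse: "w \<in> words S \<Longrightarrow> pres_eq S R (inverse_word w @ w) []"
proof (induction w)
  case Nil
  show ?case by (simp add: inverse_word_def pres_eq.refl)
next
  case (Cons x w)
  obtain s b where x: "x = (s, b)" by (cases x)
  have w: "s \<in> S" "w \<in> words S" using Cons.prems x by auto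
  have "pres_eq S R (inverse_word w @ [(s, \<not> b), (s, \<not> \<not> b)] @ w) (inverse_word w @ w)"
    using w by (intro pres_eq.cancel inverse_word_words)
  moreover have "inverse_word (x # w) @ x # w = inverse_word w @ [(s, \<not> b), (s, \<not> \<not> b)] @ w"
    by (simp add: inverse_word_def x)
  ultimately show ?case using Cons.IH[OF w(2)] by (metis pres_eq.trans)
qed

lemma group_presented_group: "group (presented_group S R)"
proof -
  let ?G = "presented_group S R" and ?c = "\<lambda>w. pres_rel S R `` {w}"
  have carr: "carrier ?G = ?c ` words S"
    by (auto simp: presented_group_def quotient_def)
  have one: "\<one>\<^bsub>?G\<^esub> = ?c []"
    by (simp add: presented_group_def)
  have mult: "?c a \<otimes>\<^bsub>?G\<^esub> ?c b = ?c (a @ b)" if "a \<in> words S" "b \<in> words S" for a b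
    using that by (rule presented_group_mult)
  show ?thesis
  proof (rule groupI)
    show "\<one>\<^bsub>?G\<^esub> \<in> carrier ?G"
      unfolding carr one by blast
  next
    fix x y assume "x \<in> carrier ?G" "y \<in> carrier ?G"
    then obtain u v where "u \<in> words S" "v \<in> words S" "x = ?c u" "y = ?c v"
      unfolding carr by blast
    then show "x \<otimes>\<^bsub>?G\<^esub> y \<in> carrier ?G"
      unfolding carr by (simp only: mult) (intro imageI, simp)
  next
    fix x y z assume "x \<in> carrier ?G" "y \<in> carrier ?G" "z \<in> carrier ?G"
    then obtain u v w where "u \<in> words S" "v \<in> words S" "w \<in> words S"
        "x = ?c u" "y = ?c v" "z = ?c w"
      unfolding carr by blast
    then show "x \<otimes>\<^bsub>?G\<^esub> y \<otimes>\<^bsub>?G\<^esub> z = x \<otimes>\<^bsub>?G\<^esub> (y \<otimes>\<^bsub>?G\<^esub> z)"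
      by (simp only: mult append_in_lists_conv append_assoc simp_thms)
  next
    fix x assume "x \<in> carrier ?G"
    then obtain w where w: "w \<in> words S" and x: "x = ?c w"
      unfolding carr by blast
    show "\<one>\<^bsub>?G\<^esub> \<otimes>\<^bsub>?G\<^esub> x = x"
      unfolding one x using mult[OF lists.Nil w] by simp
    have "?c (inverse_word w @ w) = ?c []"
      using pres_eq_inverse[OF w]
      by (intro equiv_class_eq[OF equiv_pres_rel]) (simp add: pres_rel_def)
    then show "\<exists>y\<in>carrier ?G. y \<otimes>\<^bsub>?G\<^esub> x = \<one>\<^bsub>?G\<^esub>"
      unfolding carr one x using mult[OF inverse_word_words[OF w] w] inverse_word_words[OF w]
      by (intro bexI[of _ "?c (inverse_word w)"] imageI) simp_all
  qed
qed


section \<open>Coxeter graphs and Coxeter groups\<close>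

text \<open>
  Simple graphs are symmetric loop-free digraphs without parallel arcs: an edge joining \<open>s\<close> and \<open>t\<close>
  is the pair of arcs \<open>(s, t)\<close>, \<open>(t, s)\<close>. The label \<open>m s t\<close> is meaningful only if \<open>s\<close> and \<open>t\<close> are
  joined by an edge.
\<close>

locale coxeter_graph = pair_graph \<Gamma> for \<Gamma> :: "'v pair_pre_digraph" +
  fixes m :: "'v \<Rightarrow> 'v \<Rightarrow> nat"
  assumes verts_nonempty: "pverts \<Gamma> \<noteq> {}"
    and label_sym: "(s, t) \<in> parcs \<Gamma> \<Longrightarrow> m s t = m t s"
    and label_ge_2: "(s, t) \<in> parcs \<Gamma> \<Longrightarrow> 2 \<le> m s t"

definition coxeter_relators :: "'v pair_pre_digraph \<Rightarrow> ('v \<Rightarrow> 'v \<Rightarrow> nat) \<Rightarrow> 'v word set" where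
  "coxeter_relators \<Gamma> m =
    {[(s, True), (s, True)] | s. s \<in> pverts \<Gamma>} \<union>
    {concat (replicate (m s t) [(s, True), (t, True)]) | s t. (s, t) \<in> parcs \<Gamma>}"

definition coxeter_group :: "'v pair_pre_digraph \<Rightarrow> ('v \<Rightarrow> 'v \<Rightarrow> nat) \<Rightarrow> 'v word set monoid" where
  "coxeter_group \<Gamma> m = presented_group (pverts \<Gamma>) (coxeter_relators \<Gamma> m)"


section \<open>Hyperbolic spaces\<close>

definition geodesic :: "'x set \<Rightarrow> ('x \<Rightarrow> 'x \<Rightarrow> real) \<Rightarrow> (real \<Rightarrow> 'x) \<Rightarrow> 'x \<Rightarrow> 'x \<Rightarrow> bool" where
  "geodesic X d p x y \<longleftrightarrow>
    p ` {0..d x y} \<subseteq> X \<and> p 0 = x \<and> p (d x y) = y \<and>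
    (\<forall>s\<in>{0..d x y}. \<forall>t\<in>{0..d x y}. d (p s) (p t) = \<bar>s - t\<bar>)"

definition geodesic_segment :: "'x set \<Rightarrow> ('x \<Rightarrow> 'x \<Rightarrow> real) \<Rightarrow> 'x set \<Rightarrow> 'x \<Rightarrow> 'x \<Rightarrow> bool" where
  "geodesic_segment X d A x y \<longleftrightarrow> (\<exists>p. geodesic X d p x y \<and> A = p ` {0..d x y})"

definition geodesic_space :: "'x set \<Rightarrow> ('x \<Rightarrow> 'x \<Rightarrow> real) \<Rightarrow> bool" where
  "geodesic_space X d \<longleftrightarrow>
    Metric_space X d \<and> (\<forall>x\<in>X. \<forall>y\<in>X. \<exists>A. geodesic_segment X d A x y)"

text \<open>
  Geodesic segments are compact, so \<open>u\<close> lies in the closed \<open>\<delta>\<close>-neighbourhood of \<open>A \<union> B\<close> iff some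
  point of \<open>A \<union> B\<close> is at distance at most \<open>\<delta>\<close> from \<open>u\<close>.
\<close>

definition hyperbolic_space :: "'x set \<Rightarrow> ('x \<Rightarrow> 'x \<Rightarrow> real) \<Rightarrow> bool" where
  "hyperbolic_space X d \<longleftrightarrow>
    geodesic_space X d \<and>
    (\<exists>\<delta>\<ge>0. \<forall>x\<in>X. \<forall>y\<in>X. \<forall>z\<in>X. \<forall>A B C.
      geodesic_segment X d A x y \<longrightarrow> geodesic_segment X d B y z \<longrightarrow> geodesic_segment X d C x z \<longrightarrow>
      (\<forall>u\<in>C. \<exists>v\<in>A \<union> B. d u v \<le> \<delta>))"

definition quasi_isometric_embedding ::
    "'y set \<Rightarrow> ('y \<Rightarrow> 'y \<Rightarrow> real) \<Rightarrow> 'x set \<Rightarrow> ('x \<Rightarrow> 'x \<Rightarrow> real) \<Rightarrow> ('y \<Rightarrow> 'x) \<Rightarrow> bool" where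
  "quasi_isometric_embedding Y d\<^sub>Y X d\<^sub>X q \<longleftrightarrow>
    q ` Y \<subseteq> X \<and>
    (\<exists>C\<ge>1. \<forall>a\<in>Y. \<forall>b\<in>Y.
      1 / C * d\<^sub>Y a b - C \<le> d\<^sub>X (q a) (q b) \<and> d\<^sub>X (q a) (q b) \<le> C * d\<^sub>Y a b + C)"


section \<open>Isometric actions and Property (NL)\<close>

definition isometric_action ::
    "('g, 'b) monoid_scheme \<Rightarrow> 'x set \<Rightarrow> ('x \<Rightarrow> 'x \<Rightarrow> real) \<Rightarrow> ('g \<Rightarrow> 'x \<Rightarrow> 'x) \<Rightarrow> bool" where
  "isometric_action G X d \<phi> \<longleftrightarrow>
    group_action G X \<phi> \<and> (\<forall>g\<in>carrier G. \<forall>x\<in>X. \<forall>y\<in>X. d (\<phi> g x) (\<phi> g y) = d x y)"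

definition loxodromic ::
    "('g, 'b) monoid_scheme \<Rightarrow> 'x set \<Rightarrow> ('x \<Rightarrow> 'x \<Rightarrow> real) \<Rightarrow> ('g \<Rightarrow> 'x \<Rightarrow> 'x) \<Rightarrow> 'g \<Rightarrow> bool" where
  "loxodromic G X d \<phi> g \<longleftrightarrow>
    (\<exists>x\<in>X. quasi_isometric_embedding
      UNIV (\<lambda>k l. real_of_int \<bar>k - l\<bar>) X d (\<lambda>n :: int. \<phi> (g [^]\<^bsub>G\<^esub> n) x))"

text \<open>
  One cannot quantify over all types inside a formula, so the spaces in Property (NL) are all subsets
  of \<open>'g \<times> real\<close>, with arbitrary metrics. This loses no generality. Suppose \<open>G\<close> acts on a hyperbolic
  space \<open>X\<close>, of any size, with \<open>g\<close> loxodromic. Closing an orbit under the action and under adding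
  subdivisions, with steps of length at most 1, of some geodesic between any two of its points gives
  an invariant set \<open>Y\<close> of at most \<open>|G| \<cdot> \<aleph>\<^sub>0\<close> points. Join points of \<open>Y\<close> at distance at most 1 by an
  edge. The path metric of this connected graph differs by at most 1 from the metric of \<open>X\<close> on \<open>Y\<close>,
  so its geometric realisation is hyperbolic (stability of quasi-geodesics), \<open>G\<close> acts on it by
  isometries with \<open>g\<close> loxodromic, and it has at most as many points as \<open>'g \<times> real\<close>.
\<close>

definition property_NL :: "('g, 'b) monoid_scheme \<Rightarrow> bool" where
  "property_NL G \<longleftrightarrow>
    (\<forall>(X :: ('g \<times> real) set) d \<phi>.
      X \<noteq> {} \<longrightarrow> hyperbolic_space X d \<longrightarrow> isometric_action G X d \<phi> \<longrightarrow>
      (\<forall>g\<in>carrier G. \<not> loxodromic G X d \<phi> g))"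

end

theory Submission
  imports Defs
begin

text \<open>
  A disconnected graph splits into two nonempty vertex sets with no edge between them. Since the only
  relations between distinct generators come from edges, generators on different sides are
  unrelated, and \<open>W\<^sub>\<Gamma>\<close> maps onto the infinite dihedral group: every generator on one side goes to one
  reflection of the real line, every generator on the other side to another. The relations
  survive because both ends of an edge go to the same reflection, whose square is the identity
  (\<open>hom_from_coxeter_group\<close>, \<open>line_flip_involution\<close>).

  The resulting isometric action on the line (\<open>isometric_action_hom\<close>) has a loxodromic element: the
  product of one generator from each side acts as the product of two different reflections, which is
  a nontrivial translation (\<open>line_flip_mult\<close>, \<open>translation_loxodromic\<close>). The line is hyperbolic with
  \<open>\<delta> = 0\<close>, as every triangle in it is degenerate (\<open>hyperbolic_line\<close>).
\<close>

section \<open>Homomorphisms out of a presented group\<close>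

definition word_value :: "('h, 'c) monoid_scheme \<Rightarrow> ('a \<Rightarrow> 'h) \<Rightarrow> 'a word \<Rightarrow> 'h" where
  "word_value H f w =
    foldr (\<lambda>(s, b) z. (if b then f s else inv\<^bsub>H\<^esub> f s) \<otimes>\<^bsub>H\<^esub> z) w \<one>\<^bsub>H\<^esub>"

abbreviation word_class :: "'a set \<Rightarrow> 'a word set \<Rightarrow> 'a word \<Rightarrow> 'a word set" where
  "word_class S R w \<equiv> pres_rel S R `` {w}"

lemma word_value_Nil [simp]: "word_value H f [] = \<one>\<^bsub>H\<^esub>"
  by (simp add: word_value_def)

lemma word_value_Cons [simp]:
  "word_value H f ((s, b) # w) =
    (if b then f s else inv\<^bsub>H\<^esub> f s) \<otimes>\<^bsub>H\<^esub> word_value H f w"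
  by (simp add: word_value_def)

context group
begin

lemma word_value_closed:
  "f \<in> S \<rightarrow> carrier G \<Longrightarrow> w \<in> words S \<Longrightarrow> word_value G f w \<in> carrier G"
  by (induction w) (auto simp: Pi_iff)

lemma word_value_append:
  "f \<in> S \<rightarrow> carrier G \<Longrightarrow> u \<in> words S \<Longrightarrow> v \<in> words S \<Longrightarrow>
    word_value G f (u @ v) = word_value G f u \<otimes> word_value G f v"
proof (induction u)
  case Nil
  then show ?case by (simp add: word_value_closed[of f S] del: in_lists_conv_set)
next
  case (Cons a u)
  obtain s b where a: "a = (s, b)" by (cases a)
  have "f s \<in> carrier G" "u \<in> words S"
    using Cons.prems a by (auto simp: Pi_iff)
  then show ?case
    using Cons word_value_closed[of f S u] word_value_closed[of f S v] a by (simp add: m_assoc del: in_lists_conv_set)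
qed

text \<open>
  Killing the relators suffices for invariance under all of \<open>pres_eq\<close>: the value turns concatenation
  into multiplication, so each elementary move removes a factor with trivial value.
\<close>

lemma word_value_pres_eq:
  assumes f: "f \<in> S \<rightarrow> carrier G"
    and rel: "\<And>r. r \<in> R \<Longrightarrow> r \<in> words S \<Longrightarrow> word_value G f r = \<one>"
    and eq: "pres_eq S R u v"
  shows "word_value G f u = word_value G f v"
  using eq
proof (induction rule: pres_eq.induct)
  case (cancel u v s b)
  have s: "f s \<in> carrier G" using f cancel by auto
  have "word_value G f [(s, b), (s, \<not> b)] = \<one>"
    using s by simp
  moreover have "[(s, b), (s, \<not> b)] \<in> words S" using cancel by simp
  ultimately show ?case
    using cancel f word_value_closed[OF f]
    by (simp add: word_value_append[of f S] del: in_lists_conv_set word_value_Cons append_Cons)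
next
  case (relator u v r)
  then show ?case
    using f rel word_value_closed[OF f]
    by (simp add: word_value_append[of f S] del: in_lists_conv_set)
qed simp_all

text \<open>
  Von Dyck's theorem. By the previous lemma the value of a class may be computed on any
  representative, so a chosen one serves to define the homomorphism.
\<close>

theorem hom_from_presented_group:
  assumes f: "f \<in> S \<rightarrow> carrier G"
    and rel: "\<And>r. r \<in> R \<Longrightarrow> r \<in> words S \<Longrightarrow> word_value G f r = \<one>"
  obtains h where "h \<in> hom (presented_group S R) G"
    and "\<And>s. s \<in> S \<Longrightarrow> h (word_class S R [(s, True)]) = f s"
proof
  define h where "h c = word_value G f (SOME w. w \<in> c)" for c
  have h: "h (word_class S R w) = word_value G f w" if "w \<in> words S" for w
  proof -
    have "w \<in> word_class S R w"
      using equiv_class_self[OF equiv_pres_rel that] .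
    then have "(SOME v. v \<in> word_class S R w) \<in> word_class S R w"
      by (rule someI)
    then have "pres_eq S R w (SOME v. v \<in> word_class S R w)"
      by (simp add: pres_rel_def)
    from word_value_pres_eq[OF f rel this] show ?thesis
      by (simp add: h_def)
  qed
  have carr: "carrier (presented_group S R) = word_class S R ` words S"
    by (auto simp: presented_group_def quotient_def)
  show "h \<in> hom (presented_group S R) G"
  proof (rule homI)
    fix x assume "x \<in> carrier (presented_group S R)"
    then obtain w where "w \<in> words S" "x = word_class S R w"
      unfolding carr by blast
    then show "h x \<in> carrier G"
      using h word_value_closed[OF f] by metis
  next
    fix x y assume "x \<in> carrier (presented_group S R)" "y \<in> carrier (presented_group S R)"
    then obtain u v where uv: "u \<in> words S" "v \<in> words S"
      and "x = word_class S R u" "y = word_class S R v"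
      unfolding carr by blast
    moreover have "u @ v \<in> words S" using uv by simp
    ultimately show "h (x \<otimes>\<^bsub>presented_group S R\<^esub> y) = h x \<otimes> h y"
      using h word_value_append[OF f]
      by (simp add: presented_group_mult del: in_lists_conv_set)
  qed
  fix s assume s: "s \<in> S"
  then have "f s \<in> carrier G" using f by auto
  with s show "h (word_class S R [(s, True)]) = f s"
    using h[of "[(s, True)]"] by simp
qed

text \<open>
  The relators of a Coxeter group contain no formal inverses, so their values are plain products and
  the defining relations can be checked in the form in which they are usually written.
\<close>

corollary hom_from_coxeter_group:
  assumes "coxeter_graph \<Gamma> m"
    and f: "f \<in> pverts \<Gamma> \<rightarrow> carrier G"
    and sq: "\<And>s. s \<in> pverts \<Gamma> \<Longrightarrow> f s \<otimes> f s = \<one>"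
    and edge: "\<And>s t. (s, t) \<in> parcs \<Gamma> \<Longrightarrow> (f s \<otimes> f t) [^] m s t = \<one>"
  obtains h where "h \<in> hom (coxeter_group \<Gamma> m) G"
    and "\<And>s. s \<in> pverts \<Gamma> \<Longrightarrow>
      h (word_class (pverts \<Gamma>) (coxeter_relators \<Gamma> m) [(s, True)]) = f s"
proof -
  interpret coxeter_graph \<Gamma> m by fact
  have "word_value G f r = \<one>" if "r \<in> coxeter_relators \<Gamma> m" for r
    using that unfolding coxeter_relators_def
  proof (elim UnE CollectE exE conjE)
    fix s assume s: "r = [(s, True), (s, True)]" "s \<in> pverts \<Gamma>"
    moreover from s have "f s \<in> carrier G" using f by auto
    ultimately show ?thesis
      using sq[of s] by simp
  next
    fix s t assume r: "r = concat (replicate (m s t) [(s, True), (t, True)])"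
      and st: "(s, t) \<in> parcs \<Gamma>"
    have mem: "f s \<in> carrier G" "f t \<in> carrier G"
      using st f in_arcsD1 in_arcsD2 by auto
    have "word_value G f (concat (replicate n [(s, True), (t, True)])) = (f s \<otimes> f t) [^] n"
      for n :: nat
    proof (induction n)
      case (Suc n)
      have "word_value G f (concat (replicate (Suc n) [(s, True), (t, True)]))
          = (f s \<otimes> f t) \<otimes> (f s \<otimes> f t) [^] n"
        using mem Suc by (simp add: m_assoc)
      then show ?case
        using mem by (metis m_closed nat_pow_Suc2)
    qed simp
    then show ?thesis
      using r edge[OF st] by simp
  qed
  from hom_from_presented_group[OF f this] show ?thesis
    using that unfolding coxeter_group_def by blast
qed

end

section \<open>Isometric actions as homomorphisms\<close>

text \<open>
  The isometries are taken as a subgroup of \<open>BijGroup X\<close>, so that a homomorphism into them is a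
  homomorphism into \<open>BijGroup X\<close>, that is, a group action on \<open>X\<close>. With this group as the target of
  von Dyck's theorem, only the images of the generators have to be shown to be isometries.
\<close>

definition isometry_group :: "'x set \<Rightarrow> ('x \<Rightarrow> 'x \<Rightarrow> real) \<Rightarrow> ('x \<Rightarrow> 'x) monoid" where
  "isometry_group X d =
    (BijGroup X)\<lparr>carrier := {f \<in> Bij X. \<forall>x\<in>X. \<forall>y\<in>X. d (f x) (f y) = d x y}\<rparr>"

lemma carrier_isometry_group:
  "carrier (isometry_group X d) = {f \<in> Bij X. \<forall>x\<in>X. \<forall>y\<in>X. d (f x) (f y) = d x y}"
  by (simp add: isometry_group_def)

lemma mult_isometry_group:
  "f \<in> Bij X \<Longrightarrow> g \<in> Bij X \<Longrightarrow> f \<otimes>\<^bsub>isometry_group X d\<^esub> g = compose X f g"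
  by (simp add: isometry_group_def BijGroup_def)

lemma one_isometry_group: "\<one>\<^bsub>isometry_group X d\<^esub> = (\<lambda>x\<in>X. x)"
  by (simp add: isometry_group_def BijGroup_def)

lemma group_isometry_group: "group (isometry_group X d)"
proof -
  interpret B: group "BijGroup X" by (rule group_BijGroup)
  let ?K = "{f \<in> Bij X. \<forall>x\<in>X. \<forall>y\<in>X. d (f x) (f y) = d x y}"
  have "subgroup ?K (BijGroup X)"
  proof (rule B.subgroupI)
    show "?K \<subseteq> carrier (BijGroup X)" by (auto simp: BijGroup_def)
    show "?K \<noteq> {}" using id_Bij[of X] by force
  next
    fix f assume f: "f \<in> ?K"
    have inv: "inv\<^bsub>BijGroup X\<^esub> f = (\<lambda>x\<in>X. inv_into X f x)"
      using f by (simp add: inv_BijGroup)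
    have "d (inv_into X f x) (inv_into X f y) = d x y" if "x \<in> X" "y \<in> X" for x y
    proof -
      have "d (f (inv_into X f x)) (f (inv_into X f y)) = d (inv_into X f x) (inv_into X f y)"
        using f that by (simp add: Bij_inv_into_mem)
      moreover have "f ` X = X" using f by (simp add: Bij_def bij_betw_def)
      ultimately show ?thesis using that by (simp add: f_inv_into_f)
    qed
    then show "inv\<^bsub>BijGroup X\<^esub> f \<in> ?K"
      using f by (simp add: inv restrict_inv_into_Bij)
  next
    fix f g assume fg: "f \<in> ?K" "g \<in> ?K"
    then have "g x \<in> X" if "x \<in> X" for x using that Bij_imp_funcset by blast
    with fg show "f \<otimes>\<^bsub>BijGroup X\<^esub> g \<in> ?K"
      by (simp add: BijGroup_def compose_Bij) (simp add: compose_def)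
  qed
  then show ?thesis
    unfolding isometry_group_def by (rule B.subgroup_imp_group)
qed

lemma isometric_action_hom:
  assumes "group G" and h: "h \<in> hom G (isometry_group X d)"
  shows "isometric_action G X d h"
proof -
  have "h \<in> hom G (BijGroup X)"
    using h by (auto simp: hom_def isometry_group_def BijGroup_def Pi_iff)
  then have "group_action G X h"
    using assms group_BijGroup
    by (simp add: group_action_def group_hom_def group_hom_axioms_def)
  moreover have "\<forall>g\<in>carrier G. h g \<in> carrier (isometry_group X d)"
    using h by (auto simp: hom_def)
  ultimately show ?thesis
    unfolding isometric_action_def carrier_isometry_group by blast
qed

section \<open>The real line\<close>

text \<open>
  Property (NL) ranges over spaces of points in \<open>'g \<times> real\<close>, so the line is realised as a copy of the
  reals with a fixed, arbitrary first coordinate.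
\<close>

definition line :: "'g \<Rightarrow> ('g \<times> real) set" where
  "line p = {p} \<times> UNIV"

definition line_dist :: "'g \<times> real \<Rightarrow> 'g \<times> real \<Rightarrow> real" where
  "line_dist x y = \<bar>snd x - snd y\<bar>"

text \<open>
  The reflection in the point \<open>c / 2\<close>. The restriction makes it extensional, as the elements of
  \<open>BijGroup\<close> are.
\<close>

definition line_flip :: "'g \<Rightarrow> real \<Rightarrow> 'g \<times> real \<Rightarrow> 'g \<times> real" where
  "line_flip p c = (\<lambda>x\<in>line p. (p, c - snd x))"

text \<open>
  On the line, the distances from a point of a geodesic to its two ends determine the point, so
  the geodesic between two points is unique: it is the closed interval.
\<close>

lemma geodesic_segment_line:
  assumes A: "geodesic_segment (line p) line_dist A x y" and x: "x \<in> line p" and y: "y \<in> line p"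
  shows "w \<in> A \<longleftrightarrow> w \<in> line p \<and>
    min (snd x) (snd y) \<le> snd w \<and> snd w \<le> max (snd x) (snd y)"
proof -
  let ?l = "line_dist x y"
  obtain q where q: "geodesic (line p) line_dist q x y" and Aq: "A = q ` {0..?l}"
    using A by (auto simp: geodesic_segment_def)
  have l: "?l = \<bar>snd x - snd y\<bar>" by (simp add: line_dist_def)
  have ends: "q 0 = x" "q ?l = y"
    using q by (auto simp: geodesic_def)
  have mem: "q t \<in> line p" if "t \<in> {0..?l}" for t
    using q that unfolding geodesic_def by blast
  have dist: "line_dist (q s) (q t) = \<bar>s - t\<bar>" if "s \<in> {0..?l}" "t \<in> {0..?l}" for s t
    using q that unfolding geodesic_def by blast
  have pos: "\<bar>snd x - snd (q t)\<bar> = t \<and> \<bar>snd y - snd (q t)\<bar> = ?l - t" if "t \<in> {0..?l}" for t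
    using dist[of 0 t] dist[of ?l t] that ends by (auto simp: line_dist_def)
  show ?thesis
  proof
    assume "w \<in> A"
    then obtain t where t: "t \<in> {0..?l}" "w = q t" using Aq by auto
    show "w \<in> line p \<and> min (snd x) (snd y) \<le> snd w \<and> snd w \<le> max (snd x) (snd y)"
      using mem[OF t(1)] pos[OF t(1)] t l by auto
  next
    assume w: "w \<in> line p \<and> min (snd x) (snd y) \<le> snd w \<and> snd w \<le> max (snd x) (snd y)"
    let ?t = "\<bar>snd x - snd w\<bar>"
    have t: "?t \<in> {0..?l}" using w l by auto
    \<comment> \<open>The geodesic passes through \<open>w\<close> at the time given by the distance from \<open>x\<close> to \<open>w\<close>.\<close>
    have "snd (q ?t) = snd w" using pos[OF t] w l t by (auto split: abs_split)
    then have "q ?t = w" using mem[OF t] w by (auto simp: line_def prod_eq_iff)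
    then show "w \<in> A" unfolding Aq using t by (metis image_eqI)
  qed
qed

lemma hyperbolic_line: "hyperbolic_space (line p) line_dist"
proof -
  have "Metric_space (line p) line_dist"
    by unfold_locales (auto simp: line_def line_dist_def)
  moreover have "\<exists>A. geodesic_segment (line p) line_dist A x y"
    if "x \<in> line p" "y \<in> line p" for x y
  proof -
    have "geodesic (line p) line_dist (\<lambda>t. (p, snd x + sgn (snd y - snd x) * t)) x y"
      using that
      by (auto simp: geodesic_def line_def line_dist_def sgn_if)
    then show ?thesis by (auto simp: geodesic_segment_def)
  qed
  moreover have "\<exists>v\<in>A \<union> B. line_dist u v \<le> 0"
    if "x \<in> line p" "y \<in> line p" "z \<in> line p"
      "geodesic_segment (line p) line_dist A x y" "geodesic_segment (line p) line_dist B y z"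
      "geodesic_segment (line p) line_dist C x z" "u \<in> C" for x y z A B C u
  proof -
    \<comment> \<open>The interval from \<open>x\<close> to \<open>z\<close> is covered by those from \<open>x\<close> to \<open>y\<close> and from \<open>y\<close> to \<open>z\<close>.\<close>
    have "u \<in> A \<union> B"
      using geodesic_segment_line[OF that(4), of u] geodesic_segment_line[OF that(5), of u]
        geodesic_segment_line[OF that(6), of u] that(1-3,7) by auto
    then show ?thesis by (auto simp: line_dist_def)
  qed
  ultimately show ?thesis
    unfolding hyperbolic_space_def geodesic_space_def by blast
qed

lemma line_flip_isometry: "line_flip p c \<in> carrier (isometry_group (line p) line_dist)"
proof -
  have "bij_betw (line_flip p c) (line p) (line p)"
    by (rule bij_betw_byWitness[where f' = "line_flip p c"])
      (auto simp: line_flip_def line_def)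
  then show ?thesis
    by (auto simp: carrier_isometry_group Bij_def line_flip_def line_dist_def)
qed

lemma line_flip_mult:
  "line_flip p b \<otimes>\<^bsub>isometry_group (line p) line_dist\<^esub> line_flip p c =
    (\<lambda>x\<in>line p. (p, snd x + (b - c)))"
proof -
  have "line_flip p e \<in> Bij (line p)" for e
    using line_flip_isometry[of p e] by (simp add: carrier_isometry_group)
  then have "line_flip p b \<otimes>\<^bsub>isometry_group (line p) line_dist\<^esub> line_flip p c =
      compose (line p) (line_flip p b) (line_flip p c)"
    by (intro mult_isometry_group)
  also have "\<dots> = (\<lambda>x\<in>line p. (p, snd x + (b - c)))"
    by (rule ext) (auto simp: compose_def line_flip_def line_def)
  finally show ?thesis .
qed

lemma line_flip_involution:
  "line_flip p c \<otimes>\<^bsub>isometry_group (line p) line_dist\<^esub> line_flip p c =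
    \<one>\<^bsub>isometry_group (line p) line_dist\<^esub>"
  unfolding line_flip_mult one_isometry_group by (rule restrict_ext) (auto simp: line_def)

text \<open>
  The orbit of the origin under the powers of a unit translation consists of the integers, so the
  orbit map even preserves distances.
\<close>

lemma translation_loxodromic:
  assumes "group G" and h: "h \<in> hom G (isometry_group (line p) line_dist)"
    and g: "g \<in> carrier G" and trans: "\<And>x. x \<in> line p \<Longrightarrow> h g x = (p, snd x + 1)"
  shows "loxodromic G (line p) line_dist h g"
proof -
  interpret G: group G by fact
  interpret I: group "isometry_group (line p) line_dist" by (rule group_isometry_group)
  have mult: "h (a \<otimes>\<^bsub>G\<^esub> b) x = h a (h b x)"
    if "a \<in> carrier G" "b \<in> carrier G" "x \<in> line p" for a b x
  proof -
    have "h a \<in> Bij (line p)" "h b \<in> Bij (line p)"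
      using h that by (auto simp: hom_def Pi_iff carrier_isometry_group)
    then show ?thesis
      using h that by (simp add: hom_def mult_isometry_group compose_def)
  qed
  have one: "h \<one>\<^bsub>G\<^esub> x = x" if "x \<in> line p" for x
    using hom_one[OF h G.is_group I.is_group] that by (simp add: one_isometry_group)
  have step: "h (g [^]\<^bsub>G\<^esub> (k + 1)) x = (p, snd (h (g [^]\<^bsub>G\<^esub> k) x) + 1)"
    if "x \<in> line p" for x and k :: int
  proof -
    have "h (g [^]\<^bsub>G\<^esub> k) x \<in> line p"
      using h g that by (auto simp: hom_def Pi_iff carrier_isometry_group dest!: Bij_imp_funcset)
    moreover have "g [^]\<^bsub>G\<^esub> (k + 1) = g \<otimes>\<^bsub>G\<^esub> g [^]\<^bsub>G\<^esub> k"
      using g by (metis G.int_pow_1 G.int_pow_mult add.commute)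
    ultimately show ?thesis
      using mult[of g "g [^]\<^bsub>G\<^esub> k" x] g trans that by simp
  qed
  \<comment> \<open>As \<open>step\<close> holds for all integers \<open>k\<close>, it can be read in both directions, and negative powers
    need no separate treatment of inverses.\<close>
  have pow: "snd (h (g [^]\<^bsub>G\<^esub> k) (p, 0)) = of_int k" for k :: int
  proof (induction k rule: int_induct[where k = 0])
    case base
    show ?case using one[of "(p, 0)"] by (simp add: line_def)
  next
    case (step1 k)
    then show ?case using step[of "(p, 0)" k] by (simp add: line_def)
  next
    case (step2 k)
    then show ?case using step[of "(p, 0)" "k - 1"] by (simp add: line_def)
  qed
  have mem: "h (g [^]\<^bsub>G\<^esub> k) (p, 0) \<in> line p" for k :: int
    using step[of "(p, 0)" "k - 1"] by (simp add: line_def)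
  have "quasi_isometric_embedding UNIV (\<lambda>k l. real_of_int \<bar>k - l\<bar>) (line p) line_dist
      (\<lambda>k :: int. h (g [^]\<^bsub>G\<^esub> k) (p, 0))"
    unfolding quasi_isometric_embedding_def
    using mem by (auto simp: line_dist_def pow intro!: exI[of _ 1])
  then show ?thesis
    unfolding loxodromic_def by (intro bexI[of _ "(p, 0)"]) (simp_all add: line_def)
qed

section \<open>Disconnected graphs\<close>

text \<open>
  The vertices reachable from a given vertex \<open>u\<close> form a union of components: an edge can be
  traversed in both directions, so it cannot leave or enter this set. If some vertex \<open>v\<close> is not
  reachable from \<open>u\<close>, both sides are nonempty; such a pair exists because a disconnected graph with
  at least one vertex fails strong connectedness at some pair of vertices.
\<close>

lemma (in coxeter_graph) disconnected_split:
  assumes "\<not> Digraph_Component.connected (with_proj \<Gamma>)"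
  obtains A u v where "u \<in> pverts \<Gamma>" "u \<in> A" "v \<in> pverts \<Gamma>" "v \<notin> A"
    and "\<And>s t. (s, t) \<in> parcs \<Gamma> \<Longrightarrow> s \<in> A \<longleftrightarrow> t \<in> A"
proof -
  obtain u v where uv: "u \<in> pverts \<Gamma>" "v \<in> pverts \<Gamma>" "\<not> u \<rightarrow>\<^sup>*\<^bsub>mk_symmetric \<Gamma>\<^esub> v"
    using assms verts_nonempty
    by (auto simp: Digraph_Component.connected_def strongly_connected_def)
  let ?A = "{w. u \<rightarrow>\<^sup>*\<^bsub>\<Gamma>\<^esub> w}"
  have "s \<in> ?A \<longleftrightarrow> t \<in> ?A" if "(s, t) \<in> parcs \<Gamma>" for s t
  proof -
    have "s \<rightarrow>\<^bsub>\<Gamma>\<^esub> t" "t \<rightarrow>\<^bsub>\<Gamma>\<^esub> s"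
      using that arcs_ends_symmetric[OF sym_arcs] sym_arcs by (auto simp: symmetric_def dest: symD)
    then show ?thesis using reachable_adj_trans[of u s t] reachable_adj_trans[of u t s] by auto
  qed
  moreover have "u \<in> ?A" using uv by auto
  moreover have "v \<notin> ?A" using uv reachable_mk_symmetricI by auto
  ultimately show ?thesis using that uv by blast
qed

theorem proposition14:
  fixes \<Gamma> :: "'v pair_pre_digraph" and m :: "'v \<Rightarrow> 'v \<Rightarrow> nat"
  assumes "coxeter_graph \<Gamma> m"
    and "\<not> Digraph_Component.connected (with_proj \<Gamma>)"
  shows "\<not> property_NL (coxeter_group \<Gamma> m)"
proof -
  interpret coxeter_graph \<Gamma> m by fact
  obtain A u v where u: "u \<in> pverts \<Gamma>" "u \<in> A" and v: "v \<in> pverts \<Gamma>" "v \<notin> A"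
    and split: "\<And>s t. (s, t) \<in> parcs \<Gamma> \<Longrightarrow> s \<in> A \<longleftrightarrow> t \<in> A"
    by (rule disconnected_split[OF assms(2)]) iprover
  let ?W = "coxeter_group \<Gamma> m"
  let ?p = "\<one>\<^bsub>?W\<^esub>"
  let ?I = "isometry_group (line ?p) line_dist"
  let ?gen = "\<lambda>s. word_class (pverts \<Gamma>) (coxeter_relators \<Gamma> m) [(s, True)]"
  interpret W: group ?W
    unfolding coxeter_group_def by (rule group_presented_group)
  interpret I: group ?I by (rule group_isometry_group)
  \<comment> \<open>The reflections in \<open>1/2\<close> and \<open>0\<close>; their product, in this order, is the translation by \<open>1\<close>.\<close>
  define f where "f s = line_flip ?p (if s \<in> A then 1 else 0)" for s
  have "f \<in> pverts \<Gamma> \<rightarrow> carrier ?I"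
    by (auto simp: f_def line_flip_isometry)
  moreover have sq: "f s \<otimes>\<^bsub>?I\<^esub> f s = \<one>\<^bsub>?I\<^esub>" for s
    by (simp add: f_def line_flip_involution)
  moreover have "(f s \<otimes>\<^bsub>?I\<^esub> f t) [^]\<^bsub>?I\<^esub> m s t = \<one>\<^bsub>?I\<^esub>" if "(s, t) \<in> parcs \<Gamma>" for s t
  proof -
    have "f s = f t" using split[OF that] by (simp add: f_def)
    then show ?thesis using sq by simp
  qed
  ultimately have "\<exists>h\<in>hom ?W ?I. \<forall>s\<in>pverts \<Gamma>. h (?gen s) = f s"
    by (rule I.hom_from_coxeter_group[OF assms(1), of f]) (assumption, intro bexI ballI)
  then obtain h where h: "h \<in> hom ?W ?I" and gen: "\<And>s. s \<in> pverts \<Gamma> \<Longrightarrow> h (?gen s) = f s"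
    by blast
  let ?g = "?gen u \<otimes>\<^bsub>?W\<^esub> ?gen v"
  have genW: "?gen s \<in> carrier ?W" if "s \<in> pverts \<Gamma>" for s
    using that by (auto simp: coxeter_group_def presented_group_def intro!: quotientI)
  have "h ?g = f u \<otimes>\<^bsub>?I\<^esub> f v"
    using h u v gen genW by (simp add: hom_def)
  then have "h ?g x = (?p, snd x + 1)" if "x \<in> line ?p" for x
    using that u v by (simp add: f_def line_flip_mult)
  then have "loxodromic ?W (line ?p) line_dist h ?g"
    using W.is_group h u v genW by (intro translation_loxodromic) auto
  moreover have "isometric_action ?W (line ?p) line_dist h"
    using isometric_action_hom[OF W.is_group h] .
  moreover have "?g \<in> carrier ?W" using u v genW by simp
  moreover have "line ?p \<noteq> {}" by (simp add: line_def)
  ultimately show ?thesis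
    using hyperbolic_line[of ?p] unfolding property_NL_def by metis
qed

end
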